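(* Let $X\in\mathbb{R}^{n\times d}$, $Y\in\mathbb{R}^{m\times d}$ with $Y\neq0$, let $\sigma:\mathbb{R}\to\mathbb{R}$ be twice differentiable, and let $$F(W_1,W_0)=\tfrac12\|Y-W_1\sigma(W_0X)\|_F^2,\qquad W_1\in\mathbb{R}^{m\times r},\ W_0\in\mathbb{R}^{r\times n}.$$ If $W_0$ satisfies $\sigma(W_0X)=\sigma'(W_0X)=\sigma''(W_0X)=0$, then for every $W_1$ the Hessian $\nabla^2F(W_1,W_0)$ is exactly zero and $(W_1,W_0)$ is a spurious local minimum of $F$.
   Context: The function $\sigma$ and its derivatives are applied to matrices elementwise. $\|\cdot\|_F$ is the Frobenius norm. The Hessian $\nabla^2F$ is that of $F$ as a function of the vector of all entries of $(W_1,W_0)$. In the paper's terminology a point is called a local minimum if it is a first order stationary point ($\nabla F=0$) and all eigenvalues of the Hessian $\nabla^2F$ there are nonnegative; it is a spurious local minimum if in addition the data misfit $Y-W_1\sigma(W_0X)$ is nonzero. *)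

theory Defs
  imports "HOL-Analysis.Analysis"
begin

text \<open>
  \<open>H\<close> is the Hessian matrix of \<open>f\<close> at \<open>x\<close>: \<open>f\<close> has a gradient at every point near \<open>x\<close>,
  and the gradient map is differentiable at \<open>x\<close> with Jacobian matrix \<open>H\<close>.
  A relation is used so that it asserts the existence of the second derivative as well
  as its value; derivatives being unique, \<open>H\<close> is determined by \<open>f\<close> and \<open>x\<close>.
\<close>

definition has_hessian :: "(real^'k \<Rightarrow> real) \<Rightarrow> real^'k^'k \<Rightarrow> real^'k \<Rightarrow> bool" where
  "has_hessian f H x \<longleftrightarrow>
     (\<exists>g. (\<forall>\<^sub>F y in nhds x. GDERIV f y :> g y) \<and> (g has_derivative (\<lambda>h. H *v h)) (at x))"

text \<open>Only real eigenvalues are considered: Hessians are symmetric.\<close>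

definition matrix_eigenvalue :: "real^'k^'k \<Rightarrow> real \<Rightarrow> bool" where
  "matrix_eigenvalue A l \<longleftrightarrow> (\<exists>v. v \<noteq> 0 \<and> A *v v = l *s v)"

text \<open>
  Local minimum here means a first-order stationary point at which all eigenvalues of the
  Hessian are nonnegative; it need not minimise \<open>f\<close> on a neighbourhood.
\<close>

definition second_order_local_min :: "(real^'k \<Rightarrow> real) \<Rightarrow> real^'k \<Rightarrow> bool" where
  "second_order_local_min f x \<longleftrightarrow>
     (GDERIV f x :> 0) \<and>
     (\<exists>H. has_hessian f H x \<and> (\<forall>l. matrix_eigenvalue H l \<longrightarrow> 0 \<le> l))"

text \<open>
  In \<open>real^'c^'r\<close> the index type \<open>'r\<close> ranges over rows and \<open>'c\<close> over columns.
  The norm of this type is the Frobenius norm.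
\<close>

lemma norm_matrix_Frobenius:
  fixes A :: "real^'c^'r"
  shows "norm A = sqrt (\<Sum>i\<in>UNIV. \<Sum>j\<in>UNIV. (A $ i $ j)\<^sup>2)"
  by (simp add: norm_vec_def L2_set_def sum_nonneg)

definition misfit ::
  "(real \<Rightarrow> real) \<Rightarrow> real^'d^'n \<Rightarrow> real^'d^'m \<Rightarrow> real^'r^'m \<Rightarrow> real^'n^'r \<Rightarrow> real^'d^'m" where
  "misfit \<sigma> X Y W1 W0 = Y - W1 ** map_matrix \<sigma> (W0 ** X)"

definition loss ::
  "(real \<Rightarrow> real) \<Rightarrow> real^'d^'n \<Rightarrow> real^'d^'m \<Rightarrow> real^'r^'m \<Rightarrow> real^'n^'r \<Rightarrow> real" where
  "loss \<sigma> X Y W1 W0 = 1 / 2 * (norm (misfit \<sigma> X Y W1 W0))\<^sup>2"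

text \<open>
  The vector of all entries of \<open>(W1, W0)\<close> is indexed by the disjoint union of the
  index sets of the two matrices.
\<close>

type_synonym ('m, 'r, 'n) params = "real^(('m \<times> 'r) + ('r \<times> 'n))"

definition entries :: "real^'r^'m \<Rightarrow> real^'n^'r \<Rightarrow> ('m::finite, 'r::finite, 'n::finite) params" where
  "entries W1 W0 = (\<chi> k. case k of Inl (i, j) \<Rightarrow> W1 $ i $ j | Inr (i, j) \<Rightarrow> W0 $ i $ j)"

definition outer_weights :: "('m::finite, 'r::finite, 'n::finite) params \<Rightarrow> real^'r^'m" where
  "outer_weights w = (\<chi> i j. w $ Inl (i, j))"

definition inner_weights :: "('m::finite, 'r::finite, 'n::finite) params \<Rightarrow> real^'n^'r" where
  "inner_weights w = (\<chi> i j. w $ Inr (i, j))"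

lemma outer_weights_entries [simp]: "outer_weights (entries W1 W0) = W1"
  by (simp add: outer_weights_def entries_def vec_eq_iff)

lemma inner_weights_entries [simp]: "inner_weights (entries W1 W0) = W0"
  by (simp add: inner_weights_def entries_def vec_eq_iff)

lemma entries_weights [simp]: "entries (outer_weights w) (inner_weights w) = w"
  by (auto simp: outer_weights_def inner_weights_def entries_def vec_eq_iff split: sum.split)

definition loss_entries ::
  "(real \<Rightarrow> real) \<Rightarrow> real^'d^'n \<Rightarrow> real^'d^'m \<Rightarrow> ('m::finite, 'r::finite, 'n::finite) params \<Rightarrow> real" where
  "loss_entries \<sigma> X Y w = loss \<sigma> X Y (outer_weights w) (inner_weights w)"

definition spurious_local_min ::
  "(real \<Rightarrow> real) \<Rightarrow> real^'d^'n \<Rightarrow> real^'d^'m \<Rightarrow> real^'r^'m \<Rightarrow> real^'n^'r \<Rightarrow> bool" where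
  "spurious_local_min \<sigma> X Y W1 W0 \<longleftrightarrow>
     second_order_local_min (loss_entries \<sigma> X Y) (entries W1 W0) \<and> misfit \<sigma> X Y W1 W0 \<noteq> 0"

end

theory Submission
  imports Defs
begin

text \<open>
  Each entry of \<open>\<sigma>(W0 X)\<close> is \<open>\<sigma>\<close> of a linear form in the parameters, so it vanishes at the given
  point together with its first and second derivatives. This survives multiplication by the entries
  of \<open>W1\<close>, since every term of the product rule up to second order contains one of these
  vanishing quantities. Hence every entry of the misfit has zero gradient and zero Hessian at the
  point, and so does half the sum of their squares.
\<close>

text \<open>Leaving the value \<open>f x\<close> free admits constants. A gradient map on the whole
  space lets sums and products be formed pointwise, without intersecting neighbourhoods.\<close>

definition flat_at :: "'a::real_inner \<Rightarrow> ('a \<Rightarrow> real) \<Rightarrow> bool" where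
  "flat_at x f \<longleftrightarrow>
     (\<exists>g. (\<forall>y. GDERIV f y :> g y) \<and> g x = 0 \<and> (g has_derivative (\<lambda>_. 0)) (at x))"

lemma flat_atI:
  assumes "\<And>y. GDERIV f y :> g y" "g x = 0" "(g has_derivative (\<lambda>_. 0)) (at x)"
  shows "flat_at x f"
  using assms by (auto simp: flat_at_def)

lemma flat_atE:
  assumes "flat_at x f"
  obtains g where "\<And>y. GDERIV f y :> g y" "g x = 0" "(g has_derivative (\<lambda>_. 0)) (at x)"
  using assms by (auto simp: flat_at_def)

lemma GDERIV_inner_right: "GDERIV (\<lambda>y. p \<bullet> y) y :> p"
  unfolding gderiv_def by (auto intro!: derivative_eq_intros simp: inner_commute)

lemma flat_at_const: "flat_at x (\<lambda>_. c)"
  by (rule flat_atI[where g="\<lambda>_. 0"]) (auto simp: GDERIV_const)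

lemma flat_at_add:
  assumes "flat_at x f" "flat_at x f'"
  shows "flat_at x (\<lambda>y. f y + f' y)"
proof -
  obtain g where g: "\<And>y. GDERIV f y :> g y" "g x = 0" "(g has_derivative (\<lambda>_. 0)) (at x)"
    using assms(1) by (rule flat_atE) blast
  obtain g' where g': "\<And>y. GDERIV f' y :> g' y" "g' x = 0" "(g' has_derivative (\<lambda>_. 0)) (at x)"
    using assms(2) by (rule flat_atE) blast
  show ?thesis
    by (rule flat_atI[where g="\<lambda>y. g y + g' y"])
       (use g g' in \<open>auto intro!: GDERIV_add derivative_eq_intros\<close>)
qed

lemma flat_at_sum: "(\<And>i. i \<in> A \<Longrightarrow> flat_at x (f i)) \<Longrightarrow> flat_at x (\<lambda>y. \<Sum>i\<in>A. f i y)"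
  by (induction A rule: infinite_finite_induct) (auto intro: flat_at_add flat_at_const)

text \<open>Differentiating the gradient of the product once more yields terms that each contain
  \<open>g x\<close>, \<open>g' x\<close> or a derivative at \<open>x\<close> of one of
  \<open>f\<close>, \<open>f'\<close>, \<open>g\<close>, \<open>g'\<close>; all of these
  vanish.\<close>

lemma flat_at_mult:
  assumes "flat_at x f" "flat_at x f'"
  shows "flat_at x (\<lambda>y. f y * f' y)"
proof -
  obtain g where g: "\<And>y. GDERIV f y :> g y" "g x = 0" "(g has_derivative (\<lambda>_. 0)) (at x)"
    using assms(1) by (rule flat_atE) blast
  obtain g' where g': "\<And>y. GDERIV f' y :> g' y" "g' x = 0" "(g' has_derivative (\<lambda>_. 0)) (at x)"
    using assms(2) by (rule flat_atE) blast
  have [derivative_intros]: "(f has_derivative (\<lambda>_. 0)) (at x)" "(f' has_derivative (\<lambda>_. 0)) (at x)"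
    using g(1)[of x] g'(1)[of x] g(2) g'(2) by (auto simp: gderiv_def)
  show ?thesis
    by (rule flat_atI[where g="\<lambda>y. f y *\<^sub>R g' y + f' y *\<^sub>R g y"])
       (use g g' in \<open>auto intro!: GDERIV_mult derivative_eq_intros\<close>)
qed

text \<open>The linear factor has gradient \<open>p\<close>, so it is flat only for
  \<open>p = 0\<close>. The extra gradient term \<open>f y *\<^sub>R p\<close> vanishes at
  \<open>x\<close> because \<open>f x = 0\<close>, and the mixed second-order terms vanish because
  \<open>g x = 0\<close>.\<close>

lemma flat_at_linear_mult:
  assumes "flat_at x f" "f x = 0"
  shows "flat_at x (\<lambda>y. (p \<bullet> y) * f y)"
proof -
  obtain g where g: "\<And>y. GDERIV f y :> g y" "g x = 0" "(g has_derivative (\<lambda>_. 0)) (at x)"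
    using assms(1) by (rule flat_atE) blast
  have [derivative_intros]: "(f has_derivative (\<lambda>_. 0)) (at x)"
    using g(1)[of x] g(2) by (auto simp: gderiv_def)
  show ?thesis
    by (rule flat_atI[where g="\<lambda>y. (p \<bullet> y) *\<^sub>R g y + f y *\<^sub>R p"])
       (use g assms(2) in \<open>auto intro!: GDERIV_mult GDERIV_inner_right derivative_eq_intros\<close>)
qed

lemma flat_at_compose_linear:
  fixes \<sigma> :: "real \<Rightarrow> real"
  assumes "\<And>t. \<sigma> differentiable (at t)" "deriv \<sigma> differentiable (at (q \<bullet> x))"
    and "deriv \<sigma> (q \<bullet> x) = 0" "deriv (deriv \<sigma>) (q \<bullet> x) = 0"
  shows "flat_at x (\<lambda>y. \<sigma> (q \<bullet> y))"
proof (rule flat_atI[where g="\<lambda>y. deriv \<sigma> (q \<bullet> y) *\<^sub>R q"])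
  have deriv: "DERIV f t :> deriv f t" if "f differentiable (at t)" for f :: "real \<Rightarrow> real" and t
    using that by (simp add: DERIV_deriv_iff_real_differentiable)
  show "GDERIV (\<lambda>y. \<sigma> (q \<bullet> y)) y :> deriv \<sigma> (q \<bullet> y) *\<^sub>R q" for y
    by (intro GDERIV_DERIV_compose GDERIV_inner_right deriv assms(1))
  \<comment> \<open>The gradient is a scalar function times the fixed vector \<open>q\<close>, so
    the same chain rule, applied to that scalar, gives the second derivative.\<close>
  have "GDERIV (\<lambda>y. deriv \<sigma> (q \<bullet> y)) x :> deriv (deriv \<sigma>) (q \<bullet> x) *\<^sub>R q"
    by (intro GDERIV_DERIV_compose GDERIV_inner_right deriv assms(2))
  then have "((\<lambda>y. deriv \<sigma> (q \<bullet> y)) has_derivative (\<lambda>_. 0)) (at x)"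
    using assms(4) by (simp add: gderiv_def)
  then show "((\<lambda>y. deriv \<sigma> (q \<bullet> y) *\<^sub>R q) has_derivative (\<lambda>_. 0)) (at x)"
    by (auto intro!: derivative_eq_intros)
qed (simp add: assms(3))

lemma flat_at_imp_has_hessian_0: "flat_at x f \<Longrightarrow> has_hessian f 0 x"
  unfolding flat_at_def has_hessian_def matrix_vector_mult_0 by (blast intro: always_eventually)

lemma flat_at_imp_second_order_local_min:
  assumes "flat_at x f"
  shows "second_order_local_min f x"
proof -
  have "GDERIV f x :> 0"
    using assms by (metis flat_at_def)
  \<comment> \<open>For an eigenvector \<open>v\<close> of the zero matrix,
    \<open>0 = l *s v\<close> with \<open>v \<noteq> 0\<close> forces \<open>l = 0\<close>.\<close>
  moreover have "0 \<le> l" if "matrix_eigenvalue 0 l" for l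
    using that by (auto simp: matrix_eigenvalue_def)
  ultimately show ?thesis
    using flat_at_imp_has_hessian_0[OF assms] by (auto simp: second_order_local_min_def)
qed

text \<open>Squares are written as products so that \<open>flat_at_mult\<close> applies to
  them.\<close>

lemma loss_eq_sum:
  "loss \<sigma> X Y W1 W0 =
     1 / 2 * (\<Sum>i\<in>UNIV. \<Sum>j\<in>UNIV. misfit \<sigma> X Y W1 W0 $ i $ j * misfit \<sigma> X Y W1 W0 $ i $ j)"
  by (simp add: loss_def norm_matrix_Frobenius sum_nonneg power2_eq_square)

lemma outer_weights_nth: "outer_weights w $ i $ k = axis (Inl (i, k)) 1 \<bullet> w"
  by (simp add: outer_weights_def inner_axis')

text \<open>The fixed vector carries column \<open>j\<close> of \<open>X\<close> in the coordinates
  of row \<open>k\<close> of the inner weights; it serves as \<open>q\<close> in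
  \<open>flat_at_compose_linear\<close>.\<close>

lemma inner_weights_mult_nth:
  "(inner_weights w ** X) $ k $ j = (\<Sum>l\<in>UNIV. X $ l $ j *\<^sub>R axis (Inr (k, l)) 1) \<bullet> w"
  by (simp add: inner_weights_def matrix_matrix_mult_def inner_sum_left inner_axis' mult.commute)

text \<open>The factor \<open>-1\<close> replaces subtraction, so closure under sums and products
  suffices.\<close>

lemma misfit_nth:
  "misfit \<sigma> X Y W1 W0 $ i $ j =
     Y $ i $ j + (\<Sum>k\<in>UNIV. (-1) * (W1 $ i $ k * \<sigma> ((W0 ** X) $ k $ j)))"
  by (simp add: misfit_def matrix_matrix_mult_def map_matrix_def sum_negf)

theorem corollary3p3:
  fixes X :: "real^'d^'n" and Y :: "real^'d^'m"
    and \<sigma> :: "real \<Rightarrow> real"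
    and W0 :: "real^'n^'r"
  assumes "Y \<noteq> 0"
    and "\<And>t. \<sigma> differentiable (at t)"
    and "\<And>t. deriv \<sigma> differentiable (at t)"
    and "map_matrix \<sigma> (W0 ** X) = 0"
    and "map_matrix (deriv \<sigma>) (W0 ** X) = 0"
    and "map_matrix (deriv (deriv \<sigma>)) (W0 ** X) = 0"
  shows "\<forall>W1 :: real^'r^'m.
           has_hessian (loss_entries \<sigma> X Y) 0 (entries W1 W0) \<and>
           spurious_local_min \<sigma> X Y W1 W0"
proof
  fix W1 :: "real^'r^'m"
  define x where "x = entries W1 W0"
  have W0: "inner_weights x = W0"
    by (simp add: x_def)
  have zero: "\<sigma> ((inner_weights x ** X) $ k $ j) = 0"
    "deriv \<sigma> ((inner_weights x ** X) $ k $ j) = 0"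
    "deriv (deriv \<sigma>) ((inner_weights x ** X) $ k $ j) = 0" for k j
    using assms(4-6) unfolding W0 by (simp_all add: map_matrix_def vec_eq_iff)
  have "flat_at x (\<lambda>w. \<sigma> ((inner_weights w ** X) $ k $ j))" for k j
    using zero[of k j] unfolding inner_weights_mult_nth
    by (intro flat_at_compose_linear assms)
  then have "flat_at x (\<lambda>w. outer_weights w $ i $ k * \<sigma> ((inner_weights w ** X) $ k $ j))" for i k j
    unfolding outer_weights_nth by (intro flat_at_linear_mult zero)
  then have "flat_at x (\<lambda>w. misfit \<sigma> X Y (outer_weights w) (inner_weights w) $ i $ j)" for i j
    \<comment> \<open>Fixing a constant first factor makes the product rule split off only
      \<open>-1\<close>; the outer weight, which is not flat, stays joined to its
      activation.\<close>
    unfolding misfit_nth by (intro flat_at_add flat_at_sum flat_at_mult[OF flat_at_const] flat_at_const)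
  then have flat: "flat_at x (loss_entries \<sigma> X Y)"
    unfolding loss_entries_def loss_eq_sum by (intro flat_at_sum flat_at_mult flat_at_const)
  \<comment> \<open>The hidden activations vanish at \<open>W0\<close>, hence so does the output for
    any \<open>W1\<close>.\<close>
  have "misfit \<sigma> X Y W1 W0 = Y"
    using assms(4) by (simp add: misfit_def)
  then show "has_hessian (loss_entries \<sigma> X Y) 0 (entries W1 W0) \<and> spurious_local_min \<sigma> X Y W1 W0"
    using flat_at_imp_has_hessian_0[OF flat] flat_at_imp_second_order_local_min[OF flat] assms(1)
    by (simp add: spurious_local_min_def x_def)
qed

end
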